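(* Let $n \ge 1$ be an integer and $\sigma \in (0,1)$. There exists a sequence of nonnegative smooth functions $\{v_j\}$ with compact support in $\mathbb{R}^n$ such that $v_j$ converges to the constant function $1$ in $C^2_{loc}(\mathbb{R}^n)$, and $$\lim_{j\to\infty} (-\Delta)^\sigma v_j(x) = -1 \qquad \text{for all } x \in \mathbb{R}^n.$$
   Context: For $\sigma \in (0,1)$, the fractional Laplacian is defined by $$(-\Delta)^\sigma u(x) = c_{n,\sigma}\, \mathrm{P.V.} \int_{\mathbb{R}^n} \frac{u(x)-u(y)}{|x-y|^{n+2\sigma}}\,dy, \qquad c_{n,\sigma} = \frac{2^{2\sigma}\sigma\,\Gamma\left(\frac{n+2\sigma}{2}\right)}{\pi^{n/2}\,\Gamma(1-\sigma)},$$ where $\Gamma$ is the gamma function and the principal value is $\lim_{\varepsilon\to 0^+}$ of the integral over $\{|x-y|>\varepsilon\}$. Convergence in $C^2_{loc}(\mathbb{R}^n)$ means uniform convergence of the functions and all their partial derivatives up to order $2$ on every compact subset of $\mathbb{R}^n$. *)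

theory Defs
  imports "HOL-Analysis.Analysis"
begin

definition partial :: "'n \<Rightarrow> (real ^ 'n::finite \<Rightarrow> real) \<Rightarrow> real ^ 'n \<Rightarrow> real" where
  "partial i f x = deriv (\<lambda>t. f (x + t *\<^sub>R axis i 1)) 0"

text \<open>A multi-index of order k is given as a list of k coordinates, which allows all orders of
  differentiation. The head of the list is differentiated last.\<close>

primrec iter_partial :: "'n list \<Rightarrow> (real ^ 'n::finite \<Rightarrow> real) \<Rightarrow> real ^ 'n \<Rightarrow> real" where
  "iter_partial [] f = f"
| "iter_partial (i # is) f = partial i (iter_partial is f)"

text \<open>\<open>deriv\<close> is total, so the existence of each iterated partial derivative is required
  explicitly.\<close>

definition smooth :: "(real ^ 'n::finite \<Rightarrow> real) \<Rightarrow> bool" where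
  "smooth f \<longleftrightarrow>
     (\<forall>is. continuous_on UNIV (iter_partial is f) \<and>
       (\<forall>i x. (\<lambda>t. iter_partial is f (x + t *\<^sub>R axis i 1)) field_differentiable (at 0)))"

definition compactly_supported :: "(real ^ 'n::finite \<Rightarrow> real) \<Rightarrow> bool" where
  "compactly_supported f \<longleftrightarrow> compact (closure {x. f x \<noteq> 0})"

text \<open>Intended for functions of class C2, where the partial derivatives involved exist.\<close>

definition converges_C2_loc ::
    "(nat \<Rightarrow> real ^ 'n::finite \<Rightarrow> real) \<Rightarrow> (real ^ 'n \<Rightarrow> real) \<Rightarrow> bool" where
  "converges_C2_loc v f \<longleftrightarrow>
     (\<forall>K is. compact K \<longrightarrow> length is \<le> 2 \<longrightarrow>
        uniform_limit K (\<lambda>j. iter_partial is (v j)) (iter_partial is f) sequentially)"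

definition frac_const :: "nat \<Rightarrow> real \<Rightarrow> real" where
  "frac_const n \<sigma> =
     2 powr (2 * \<sigma>) * \<sigma> * Gamma ((real n + 2 * \<sigma>) / 2) / (pi powr (real n / 2) * Gamma (1 - \<sigma>))"

definition frac_kernel :: "real \<Rightarrow> (real ^ 'n::finite \<Rightarrow> real) \<Rightarrow> real ^ 'n \<Rightarrow> real ^ 'n \<Rightarrow> real" where
  "frac_kernel \<sigma> u x y = (u x - u y) / norm (x - y) powr (real CARD('n) + 2 * \<sigma>)"

definition truncated_integral ::
    "real \<Rightarrow> (real ^ 'n::finite \<Rightarrow> real) \<Rightarrow> real ^ 'n \<Rightarrow> real \<Rightarrow> real" where
  "truncated_integral \<sigma> u x \<epsilon> =
     (LINT y:{y. norm (x - y) > \<epsilon>}|lborel. frac_kernel \<sigma> u x y)"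

text \<open>The integral and \<open>Lim\<close> are total functions; this predicate says that \<open>frac_laplacian\<close> below
  is a genuine principal value.\<close>

definition frac_laplacian_exists ::
    "real \<Rightarrow> (real ^ 'n::finite \<Rightarrow> real) \<Rightarrow> real ^ 'n \<Rightarrow> bool" where
  "frac_laplacian_exists \<sigma> u x \<longleftrightarrow>
     (\<forall>\<epsilon>>0. set_integrable lborel {y. norm (x - y) > \<epsilon>} (frac_kernel \<sigma> u x)) \<and>
     (\<exists>l. (truncated_integral \<sigma> u x \<longlongrightarrow> l) (at_right 0))"

definition frac_laplacian :: "real \<Rightarrow> (real ^ 'n::finite \<Rightarrow> real) \<Rightarrow> real ^ 'n \<Rightarrow> real" where
  "frac_laplacian \<sigma> u x =
     frac_const CARD('n) \<sigma> * Lim (at_right 0) (truncated_integral \<sigma> u x)"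

end

theory Submission
  imports Defs
begin

text \<open>Let \<open>v\<close> be \<open>1\<close> on the ball of radius \<open>R\<close>, plus a hump of height of order \<open>R powr (2 * \<sigma>)\<close> in
  the shell \<open>R \<le> norm y \<le> 2 * R\<close>. Inside the ball the fractional Laplacian of \<open>v\<close> is an ordinary
  integral. Cutting off the constant \<open>1\<close> outside the ball contributes only \<open>O(R powr (- 2 * \<sigma>))\<close>, while
  the contribution of the hump does not decay: by homogeneity of the kernel it converges to minus
  the integral of the rescaled hump against \<open>norm z powr (- n - 2 * \<sigma>)\<close> in dimension \<open>n\<close>, times
  \<open>frac_const n \<sigma>\<close>, and the height is normalised so that this is \<open>-1\<close>.\<close>

subsection \<open>Smooth functions generated by \<open>exp (- 1 / t)\<close>\<close>

text \<open>The polynomial parameter makes the family stable under differentiation;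
  \<open>flat_exp 1\<close> is the classical function \<open>exp (- 1 / t)\<close> extended by
  zero.\<close>

definition flat_exp :: "real poly \<Rightarrow> real \<Rightarrow> real" where
  "flat_exp p t = (if t > 0 then poly p (1 / t) * exp (- (1 / t)) else 0)"

lemma poly_times_exp_minus_tendsto_0:
  fixes p :: "real poly"
  shows "((\<lambda>s. poly p s * exp (- s)) \<longlongrightarrow> 0) at_top"
proof -
  have "((\<lambda>s. \<Sum>i\<le>degree p. coeff p i * (s ^ i / exp s)) \<longlongrightarrow> (\<Sum>i\<le>degree p. coeff p i * 0)) at_top"
    by (intro tendsto_sum tendsto_mult tendsto_const tendsto_power_div_exp_0)
  then show ?thesis
    by (simp add: poly_altdef sum_distrib_right exp_minus divide_inverse mult.assoc)
qed

text \<open>With \<open>s = 1 / t\<close> one has d/dt = - s^2 d/ds, which turns p(s) exp(-s) into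
  s^2 (p(s) - p'(s)) exp(-s); \<open>[:0, 0, 1:]\<close> is the factor s^2. At the origin the
  exponential beats every polynomial in s.\<close>

lemma flat_exp_has_real_derivative:
  "(flat_exp p has_real_derivative flat_exp ([:0, 0, 1:] * (p - pderiv p)) t) (at t)"
proof -
  consider "t > 0" | "t < 0" | "t = 0" by linarith
  then show ?thesis
  proof cases
    case 1
    have "((\<lambda>t. poly p (1 / t) * exp (- (1 / t))) has_real_derivative
        flat_exp ([:0, 0, 1:] * (p - pderiv p)) t) (at t)"
      using 1
      by (auto intro!: derivative_eq_intros DERIV_chain'[OF _ poly_DERIV]
          simp: flat_exp_def field_simps power2_eq_square)
    then show ?thesis
      by (rule has_field_derivative_transform_within_open[of _ _ _ "{0<..}"])
        (use 1 in \<open>auto simp: flat_exp_def\<close>)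
  next
    case 2
    have "((\<lambda>t. 0) has_real_derivative flat_exp ([:0, 0, 1:] * (p - pderiv p)) t) (at t)"
      using 2 by (simp add: flat_exp_def)
    then show ?thesis
      by (rule has_field_derivative_transform_within_open[of _ _ _ "{..<0}"])
        (use 2 in \<open>auto simp: flat_exp_def\<close>)
  next
    case 3
    \<comment> \<open>\<open>pCons 0 p\<close> is s p(s): dividing by \<open>h\<close> in the
      difference quotient costs one more factor s = 1/h.\<close>
    have "((\<lambda>h. poly (pCons 0 p) (inverse h) * exp (- inverse h)) \<longlongrightarrow> 0) (at_right 0)"
      by (rule filterlim_compose[OF poly_times_exp_minus_tendsto_0 filterlim_inverse_at_top_right])
    then have "((\<lambda>h. flat_exp p h / h) \<longlongrightarrow> 0) (at_right 0)"
      by (rule Lim_transform_eventually)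
        (auto simp: eventually_at_filter flat_exp_def field_simps)
    moreover have "((\<lambda>h. flat_exp p h / h) \<longlongrightarrow> 0) (at_left 0)"
      by (rule Lim_transform_eventually[OF tendsto_const])
        (auto simp: eventually_at_filter flat_exp_def)
    ultimately have "((\<lambda>h. flat_exp p h / h) \<longlongrightarrow> 0) (at 0)"
      by (simp add: filterlim_split_at)
    then show ?thesis
      using 3 by (simp add: DERIV_def flat_exp_def)
  qed
qed

text \<open>An algebra of functions closed under partial derivatives, so that all its members are smooth and
  no quotients or integrals are needed to build cut-off functions.\<close>

inductive_set flat_algebra :: "(real ^ 'n::finite \<Rightarrow> real) set" where
  const: "(\<lambda>x. c) \<in> flat_algebra"
| coord: "(\<lambda>x. x $ i) \<in> flat_algebra"
| add: "f \<in> flat_algebra \<Longrightarrow> g \<in> flat_algebra \<Longrightarrow> (\<lambda>x. f x + g x) \<in> flat_algebra"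
| mult: "f \<in> flat_algebra \<Longrightarrow> g \<in> flat_algebra \<Longrightarrow> (\<lambda>x. f x * g x) \<in> flat_algebra"
| flat: "f \<in> flat_algebra \<Longrightarrow> (\<lambda>x. flat_exp p (f x)) \<in> flat_algebra"

lemma flat_algebra_sum:
  "finite I \<Longrightarrow> (\<And>i. i \<in> I \<Longrightarrow> f i \<in> flat_algebra) \<Longrightarrow> (\<lambda>x. \<Sum>i\<in>I. f i x) \<in> flat_algebra"
  by (induction I rule: finite_induct) (auto intro: flat_algebra.intros)

lemma flat_algebra_inner: "(\<lambda>x. x \<bullet> x) \<in> flat_algebra"
  by (simp add: inner_vec_def) (intro flat_algebra_sum flat_algebra.intros finite)

text \<open>Sum, product and chain rule produce gradients that stay in the algebra. The full
  derivative, not only the partial ones, is recorded because the mean value inequality below uses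
  it.\<close>

lemma flat_algebra_has_derivative:
  fixes f :: "real ^ 'n::finite \<Rightarrow> real"
  assumes "f \<in> flat_algebra"
  shows "\<exists>D. (\<forall>i. D i \<in> flat_algebra) \<and>
    (\<forall>x. (f has_derivative (\<lambda>z. \<Sum>i\<in>UNIV. z $ i * D i x)) (at x))"
  using assms
proof induction
  case (const c)
  show ?case
    by (rule exI[of _ "\<lambda>i x. 0"]) (auto intro: flat_algebra.const)
next
  case (coord j)
  have "((\<lambda>x. x $ j) has_derivative (\<lambda>z. \<Sum>i\<in>UNIV. z $ i * (if i = j then 1 else 0))) (at x)"
    for x :: "real ^ 'n"
    by (simp add: if_distrib sum.delta cong: if_cong)
      (rule bounded_linear_imp_has_derivative[OF bounded_linear_vec_nth])
  then show ?case
    by (intro exI[of _ "\<lambda>i x. if i = j then 1 else 0"]) (auto intro: flat_algebra.const)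
next
  case (add f g)
  then obtain D E where "\<forall>i. D i \<in> flat_algebra" "\<forall>i. E i \<in> flat_algebra"
    and *: "\<forall>x. (f has_derivative (\<lambda>z. \<Sum>i\<in>UNIV. z $ i * D i x)) (at x)"
      "\<forall>x. (g has_derivative (\<lambda>z. \<Sum>i\<in>UNIV. z $ i * E i x)) (at x)"
    by blast
  moreover have "((\<lambda>x. f x + g x) has_derivative (\<lambda>z. \<Sum>i\<in>UNIV. z $ i * (D i x + E i x))) (at x)" for x
    by (rule derivative_eq_intros *[rule_format])+
      (auto simp: algebra_simps sum.distrib)
  ultimately show ?case
    by (intro exI[of _ "\<lambda>i x. D i x + E i x"]) (simp add: flat_algebra.add)
next
  case (mult f g)
  then obtain D E where "\<forall>i. D i \<in> flat_algebra" "\<forall>i. E i \<in> flat_algebra"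
    and *: "\<forall>x. (f has_derivative (\<lambda>z. \<Sum>i\<in>UNIV. z $ i * D i x)) (at x)"
      "\<forall>x. (g has_derivative (\<lambda>z. \<Sum>i\<in>UNIV. z $ i * E i x)) (at x)"
    by blast
  moreover have "((\<lambda>x. f x * g x) has_derivative
      (\<lambda>z. \<Sum>i\<in>UNIV. z $ i * (f x * E i x + D i x * g x))) (at x)" for x
    by (rule derivative_eq_intros *[rule_format])+
      (auto simp: algebra_simps sum.distrib sum_distrib_left)
  ultimately show ?case
    using mult.hyps
    by (intro exI[of _ "\<lambda>i x. f x * E i x + D i x * g x"])
      (simp add: flat_algebra.add flat_algebra.mult)
next
  case (flat f p)
  let ?q = "[:0, 0, 1:] * (p - pderiv p)"
  obtain D where "\<forall>i. D i \<in> flat_algebra"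
    and *: "\<forall>x. (f has_derivative (\<lambda>z. \<Sum>i\<in>UNIV. z $ i * D i x)) (at x)"
    using flat by blast
  moreover have "((\<lambda>x. flat_exp p (f x)) has_derivative
      (\<lambda>z. \<Sum>i\<in>UNIV. z $ i * (flat_exp ?q (f x) * D i x))) (at x)" for x
    by (rule has_derivative_eq_rhs[OF has_derivative_compose[OF *[rule_format]
            flat_exp_has_real_derivative[unfolded has_field_derivative_def]]])
      (simp add: fun_eq_iff sum_distrib_left sum_distrib_right ac_simps)
  ultimately show ?case
    using flat.hyps
    by (intro exI[of _ "\<lambda>i x. flat_exp ?q (f x) * D i x"])
      (simp add: flat_algebra.flat flat_algebra.mult)
qed

lemma flat_algebra_continuous: "f \<in> flat_algebra \<Longrightarrow> continuous_on S f"
  using flat_algebra_has_derivative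
  by (intro continuous_at_imp_continuous_on) (blast intro: has_derivative_continuous)

text \<open>Composing the full derivative with a coordinate line identifies
  \<open>partial i f\<close> with the component \<open>D i\<close>, so membership passes to partial
  derivatives and induction reaches all orders.\<close>

lemma flat_algebra_partial:
  assumes "f \<in> flat_algebra"
  shows "partial i f \<in> flat_algebra"
    and "(\<lambda>t. f (x + t *\<^sub>R axis i 1)) field_differentiable (at 0)"
proof -
  obtain D where D: "\<And>i. D i \<in> flat_algebra"
    "\<And>x. (f has_derivative (\<lambda>z. \<Sum>i\<in>UNIV. z $ i * D i x)) (at x)"
    using flat_algebra_has_derivative[OF assms] by blast
  have *: "((\<lambda>t. f (x + t *\<^sub>R axis i 1)) has_real_derivative D i x) (at 0)" for x
  proof -
    have "((\<lambda>t::real. x + t *\<^sub>R axis i 1) has_derivative (\<lambda>t. t *\<^sub>R axis i 1)) (at 0)"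
      by (auto intro!: derivative_eq_intros)
    then have "((\<lambda>t. f (x + t *\<^sub>R axis i 1)) has_derivative
        (\<lambda>t. \<Sum>j\<in>UNIV. (t *\<^sub>R axis i 1) $ j * D j (x + 0 *\<^sub>R axis i 1))) (at 0)"
      by (rule has_derivative_compose) (rule D(2))
    moreover have "(\<Sum>j\<in>UNIV. (t *\<^sub>R axis i 1) $ j * D j (x + 0 *\<^sub>R axis i 1)) = D i x * t" for t
      by (simp add: axis_def if_distrib if_distribR sum.delta cong: if_cong)
    ultimately show ?thesis
      by (simp add: has_field_derivative_def)
  qed
  then have "partial i f = D i"
    unfolding partial_def by (auto intro: DERIV_imp_deriv)
  then show "partial i f \<in> flat_algebra"
    by (simp add: D)
  show "(\<lambda>t. f (x + t *\<^sub>R axis i 1)) field_differentiable (at 0)"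
    using * by (auto simp: field_differentiable_def)
qed

lemma flat_algebra_iter_partial: "f \<in> flat_algebra \<Longrightarrow> iter_partial is f \<in> flat_algebra"
  by (induction "is") (auto intro: flat_algebra_partial)

lemma flat_algebra_smooth: "f \<in> flat_algebra \<Longrightarrow> smooth f"
  unfolding smooth_def
  by (blast intro: flat_algebra_iter_partial flat_algebra_continuous flat_algebra_partial)

section \<open>Local first and second order estimates\<close>

lemma flat_algebra_lipschitz_on_ball:
  fixes f :: "real ^ 'n::finite \<Rightarrow> real"
  assumes "f \<in> flat_algebra"
  obtains C where "\<And>z. norm z \<le> 1 \<Longrightarrow> \<bar>f (x + z) - f x\<bar> \<le> C * norm z"
proof -
  obtain D where D: "\<And>i. D i \<in> flat_algebra"
    "\<And>x. (f has_derivative (\<lambda>z. \<Sum>i\<in>UNIV. z $ i * D i x)) (at x)"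
    using flat_algebra_has_derivative[OF assms] by blast
  \<comment> \<open>The gradient is continuous, hence bounded on the compact ball; the ball is also
    convex, as the mean value inequality requires.\<close>
  have "\<exists>B. \<forall>y\<in>cball x 1. \<bar>D i y\<bar> \<le> B" for i
    using compact_continuous_image[OF flat_algebra_continuous[OF D(1)], of "cball x 1" i]
    by (auto dest!: compact_imp_bounded simp: bounded_iff)
  then obtain B where B: "\<And>i y. y \<in> cball x 1 \<Longrightarrow> \<bar>D i y\<bar> \<le> B i"
    by metis
  have "norm (f (x + z) - f x) \<le> (\<Sum>i\<in>UNIV. B i) * norm ((x + z) - x)" if "norm z \<le> 1" for z
  proof (rule differentiable_bound[of "cball x 1"])
    show "(f has_derivative (\<lambda>z. \<Sum>i\<in>UNIV. z $ i * D i y)) (at y within cball x 1)" for y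
      using D(2) by (rule has_derivative_at_withinI)
    show "onorm (\<lambda>z. \<Sum>i\<in>UNIV. z $ i * D i y) \<le> (\<Sum>i\<in>UNIV. B i)" if "y \<in> cball x 1" for y
    proof (rule onorm_le)
      fix z :: "real ^ 'n"
      have "norm (\<Sum>i\<in>UNIV. z $ i * D i y) \<le> (\<Sum>i\<in>UNIV. norm z * B i)"
        by (rule sum_norm_le) (use B[OF that] in \<open>auto simp: abs_mult intro!: mult_mono component_le_norm_cart\<close>)
      then show "norm (\<Sum>i\<in>UNIV. z $ i * D i y) \<le> (\<Sum>i\<in>UNIV. B i) * norm z"
        by (simp add: sum_distrib_left mult.commute)
    qed
  qed (use that in \<open>auto simp: dist_norm\<close>)
  then show thesis
    by (intro that) auto
qed

text \<open>The linear Taylor terms at \<open>z\<close> and \<open>- z\<close> cancel because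
  \<open>L\<close> is odd, and each remainder is quadratic because the gradient is Lipschitz near
  \<open>x\<close>. This gain of two powers tames the kernel at its singularity.\<close>

lemma flat_algebra_second_difference:
  fixes f :: "real ^ 'n::finite \<Rightarrow> real"
  assumes "f \<in> flat_algebra"
  obtains C where "\<And>z. norm z \<le> 1 \<Longrightarrow> \<bar>2 * f x - f (x + z) - f (x - z)\<bar> \<le> C * (norm z)\<^sup>2"
proof -
  obtain D where D: "\<And>i. D i \<in> flat_algebra"
    "\<And>x. (f has_derivative (\<lambda>z. \<Sum>i\<in>UNIV. z $ i * D i x)) (at x)"
    using flat_algebra_has_derivative[OF assms] by blast
  have "\<exists>C. \<forall>w. norm w \<le> 1 \<longrightarrow> \<bar>D i (x + w) - D i x\<bar> \<le> C * norm w" for i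
    using flat_algebra_lipschitz_on_ball[OF D(1)] by metis
  then obtain C where C: "\<And>i w. norm w \<le> 1 \<Longrightarrow> \<bar>D i (x + w) - D i x\<bar> \<le> C i * norm w"
    by metis
  define L where "L z = (\<Sum>i\<in>UNIV. z $ i * D i x)" for z :: "real ^ 'n"
  have L: "bounded_linear L"
    using D(2)[of x] by (simp add: L_def[abs_def] has_derivative_bounded_linear)
  have taylor: "\<bar>f (x + z) - f x - L z\<bar> \<le> (\<Sum>i\<in>UNIV. C i) * (norm z)\<^sup>2"
    if z: "norm z \<le> 1" for z
  proof -
    \<comment> \<open>After subtracting \<open>L\<close>, the gradient at \<open>w\<close> is the
      increment of \<open>D\<close> from \<open>x\<close> to \<open>x + w\<close>, of size at most a
      constant times \<open>norm z\<close> on the ball of radius \<open>norm z\<close>. The mean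
      value inequality supplies the second factor \<open>norm z\<close>.\<close>
    let ?g = "\<lambda>w :: real ^ 'n. f (x + w) - L w"
    have "norm (?g z - ?g 0) \<le> ((\<Sum>i\<in>UNIV. C i) * norm z) * norm (z - 0)"
    proof (rule differentiable_bound[of "cball 0 (norm z)"])
      fix w :: "real ^ 'n"
      assume w: "w \<in> cball 0 (norm z)"
      have shift: "((\<lambda>w. x + w) has_derivative (\<lambda>v. v)) (at w)"
        by (auto intro!: derivative_eq_intros)
      have "((\<lambda>w. f (x + w)) has_derivative (\<lambda>v. \<Sum>i\<in>UNIV. v $ i * D i (x + w))) (at w)"
        by (rule has_derivative_compose[OF shift, where g = f]) (rule D(2))
      then show "(?g has_derivative (\<lambda>v. (\<Sum>i\<in>UNIV. v $ i * D i (x + w)) - L v)) (at w within cball 0 (norm z))"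
        by (intro has_derivative_at_withinI[OF has_derivative_diff]
            bounded_linear_imp_has_derivative L)
      show "onorm (\<lambda>v. (\<Sum>i\<in>UNIV. v $ i * D i (x + w)) - L v) \<le> (\<Sum>i\<in>UNIV. C i) * norm z"
      proof (rule onorm_le)
        fix v :: "real ^ 'n"
        \<comment> \<open>Testing the Lipschitz bound on a unit vector gives the sign that allows
          \<open>norm w\<close> to be enlarged to \<open>norm z\<close>.\<close>
        have C_nonneg: "0 \<le> C i" for i
          using C[of "axis i 1" i] by simp
        have *: "norm (v $ i * (D i (x + w) - D i x)) \<le> norm v * (C i * norm z)" for i
        proof -
          have "\<bar>D i (x + w) - D i x\<bar> \<le> C i * norm w"
            using C w z by auto
          also have "\<dots> \<le> C i * norm z"
            using w C_nonneg by (auto intro: mult_left_mono)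
          finally show ?thesis
            by (auto simp: abs_mult intro!: mult_mono component_le_norm_cart)
        qed
        have "(\<Sum>i\<in>UNIV. v $ i * D i (x + w)) - L v = (\<Sum>i\<in>UNIV. v $ i * (D i (x + w) - D i x))"
          by (simp add: L_def sum_subtractf algebra_simps)
        also have "norm \<dots> \<le> (\<Sum>i\<in>UNIV. norm v * (C i * norm z))"
          by (rule sum_norm_le) (rule *)
        finally show "norm ((\<Sum>i\<in>UNIV. v $ i * D i (x + w)) - L v) \<le> (\<Sum>i\<in>UNIV. C i) * norm z * norm v"
          by (simp add: sum_distrib_left sum_distrib_right ac_simps)
      qed
    qed auto
    moreover have "L 0 = 0" by (simp add: L_def)
    ultimately show ?thesis
      by (simp add: power2_eq_square ac_simps)
  qed
  have "\<bar>2 * f x - f (x + z) - f (x - z)\<bar> \<le> 2 * (\<Sum>i\<in>UNIV. C i) * (norm z)\<^sup>2" if "norm z \<le> 1" for z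
  proof -
    have "L (- z) = - L z" by (simp add: L_def sum_negf)
    then show ?thesis
      using taylor[of z] taylor[of "- z"] that by simp
  qed
  then show thesis by (rule that)
qed

text \<open>Derivatives are local: a short piece of the coordinate line through \<open>x\<close>
  stays in \<open>U\<close>, so the induction hypothesis applies near \<open>t = 0\<close>. It
  transfers the derivatives of the constant function to the plateau.\<close>

lemma iter_partial_cong_open:
  assumes "open U" and "\<And>y. y \<in> U \<Longrightarrow> f y = g y" and "x \<in> U"
  shows "iter_partial is f x = iter_partial is g x"
  using assms(3)
proof (induction "is" arbitrary: x)
  case Nil
  then show ?case using assms(2) by simp
next
  case (Cons i "is")
  have "open ((\<lambda>t::real. x + t *\<^sub>R axis i 1) -` U)"
    by (intro open_vimage assms continuous_intros)
  then have "\<forall>\<^sub>F t in nhds 0. x + t *\<^sub>R axis i 1 \<in> U"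
    using Cons.prems by (auto simp: eventually_nhds vimage_def intro!: exI[of _ "(\<lambda>t::real. x + t *\<^sub>R axis i 1) -` U"])
  then have "\<forall>\<^sub>F t in nhds 0. iter_partial is f (x + t *\<^sub>R axis i 1) = iter_partial is g (x + t *\<^sub>R axis i 1)"
    by eventually_elim (rule Cons.IH)
  then show ?case
    by (simp add: partial_def deriv_cong_ev)
qed

subsection \<open>Integrability of powers of the norm\<close>

text \<open>Affine change of variables, applied below to translations, to the reflection
  \<open>c = - 1\<close> and to the dilation by \<open>R\<close>.\<close>

lemma
  fixes f :: "'a::euclidean_space \<Rightarrow> real"
  assumes [measurable]: "f \<in> borel_measurable borel" and c: "c \<noteq> 0"
  shows lborel_integrable_affine_iff: "integrable lborel (\<lambda>x. f (t + c *\<^sub>R x)) \<longleftrightarrow> integrable lborel f"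
    and lborel_integral_affine: "(\<integral>x. f x \<partial>lborel) = \<bar>c\<bar> ^ DIM('a) * (\<integral>x. f (t + c *\<^sub>R x) \<partial>lborel)"
proof -
  show "integrable lborel (\<lambda>x. f (t + c *\<^sub>R x)) \<longleftrightarrow> integrable lborel f"
    using c by (subst (2) lborel_affine[of c t]) (simp_all add: integrable_density integrable_distr_eq)
  show "(\<integral>x. f x \<partial>lborel) = \<bar>c\<bar> ^ DIM('a) * (\<integral>x. f (t + c *\<^sub>R x) \<partial>lborel)"
    using c by (subst lborel_affine[of c t]) (simp_all add: integral_density integral_distr)
qed

lemma term_le_suminf: "f k \<le> suminf f" for f :: "nat \<Rightarrow> ennreal"
  using sum_le_suminf[of f "{k}"] by simp

text \<open>Summing over geometric shells replaces polar coordinates: \<open>r > 1\<close> covers a neighbourhood of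
  infinity and \<open>r < 1\<close> a punctured neighbourhood of the origin.\<close>

lemma set_integrable_norm_powr_shells:
  fixes S :: "'a::euclidean_space set"
  assumes r: "0 < r" and c: "0 < c" and conv: "r powr (real DIM('a) - b) < 1"
    and [measurable]: "S \<in> sets borel"
    and cover: "\<And>z. z \<in> S \<Longrightarrow> \<exists>k. c * r ^ k \<le> norm z \<and> norm z \<le> 2 * (c * r ^ k)"
  shows "set_integrable lborel S (\<lambda>z. norm z powr (- b))"
proof -
  define n where "n = DIM('a)"
  \<comment> \<open>\<open>m k\<close> dominates the integrand on the k-th shell. There the ratio of
    \<open>norm z\<close> to \<open>c * r ^ k\<close> lies between 1 and 2, and the exponent
    \<open>\<bar>b\<bar>\<close> handles both signs of \<open>b\<close>.\<close>
  define m where "m k = 2 powr \<bar>b\<bar> * (c * r ^ k) powr (- b)" for k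
  \<comment> \<open>Full balls contain the shells and have an explicit volume; the overlap costs
    only a constant factor.\<close>
  define A :: "nat \<Rightarrow> 'a set" where "A k = cball 0 (2 * (c * r ^ k))" for k
  define F where "F z = indicator S z * norm z powr (- b)" for z :: 'a
  define q where "q = r powr (real n - b)"
  define K where "K = 2 powr \<bar>b\<bar> * c powr (- b) * unit_ball_vol n * (2 * c) ^ n"
  have meas [measurable]: "F \<in> borel_measurable lborel"
    unfolding F_def by measurable
  have A_sets [measurable]: "A k \<in> sets lborel" for k
    by (simp add: A_def)
  have shell: "norm z powr (- b) \<le> m k" if z: "c * r ^ k \<le> norm z" "norm z \<le> 2 * (c * r ^ k)" for z :: 'a and k
  proof -
    have pos: "0 < c * r ^ k" using r c by simp
    let ?s = "norm z / (c * r ^ k)"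
    have s: "1 \<le> ?s" "?s \<le> 2" using z pos by (simp_all add: field_simps)
    have "?s powr (- b) \<le> ?s powr \<bar>b\<bar>"
      using s by (intro powr_mono) auto
    also have "\<dots> \<le> 2 powr \<bar>b\<bar>"
      using s by (intro powr_mono2) auto
    finally have "?s powr (- b) * (c * r ^ k) powr (- b) \<le> m k"
      unfolding m_def by (intro mult_right_mono) auto
    moreover have "norm z = ?s * (c * r ^ k)" using pos by (metis less_irrefl nonzero_eq_divide_eq)
    ultimately show ?thesis
      using s pos by (metis powr_mult)
  qed
  \<comment> \<open>The bound scales like r^(-bk) and the volume like r^(nk), so the terms form a
    geometric series of ratio \<open>q\<close>, which is below 1 by \<open>conv\<close>.\<close>
  have term_eq: "ennreal (m k) * emeasure lborel (A k) = ennreal (K * q ^ k)" for k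
  proof -
    have "(r ^ k) powr (- b) * (r ^ k) ^ n = q ^ k"
    proof -
      have "(r ^ k) powr (- b) * (r ^ k) ^ n = (r ^ k) powr (- b) * (r ^ k) powr real n"
        using r by (simp add: powr_realpow)
      also have "\<dots> = (r ^ k) powr (- b + real n)"
        by (rule powr_add[symmetric])
      also have "\<dots> = (r powr real k) powr (real n - b)"
        using r by (simp add: powr_realpow)
      also have "\<dots> = q powr real k"
        by (simp add: q_def powr_powr mult.commute)
      also have "\<dots> = q ^ k"
        using r by (intro powr_realpow) (simp add: q_def)
      finally show ?thesis .
    qed
    moreover have "m k * (unit_ball_vol n * (2 * (c * r ^ k)) ^ n) =
        K * ((r ^ k) powr (- b) * (r ^ k) ^ n)"
      using r c by (simp add: m_def K_def powr_mult power_mult_distrib)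
    ultimately have "m k * (unit_ball_vol n * (2 * (c * r ^ k)) ^ n) = K * q ^ k"
      by simp
    moreover have "emeasure lborel (A k) = ennreal (unit_ball_vol n * (2 * (c * r ^ k)) ^ n)"
      using r c unfolding A_def n_def by (subst emeasure_cball) auto
    moreover have "0 \<le> m k" by (simp add: m_def)
    ultimately show ?thesis
      by (simp add: ennreal_mult'[symmetric])
  qed
  have "ennreal (F z) \<le> (\<Sum>k. ennreal (m k) * indicator (A k) z)" for z
  proof (cases "z \<in> S")
    case True
    then obtain k where k: "c * r ^ k \<le> norm z" "norm z \<le> 2 * (c * r ^ k)"
      using cover by blast
    have "ennreal (F z) \<le> ennreal (m k) * indicator (A k) z"
      using True k shell[OF k] by (simp add: F_def A_def ennreal_leI)
    also have "\<dots> \<le> (\<Sum>k. ennreal (m k) * indicator (A k) z)"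
      by (rule term_le_suminf)
    finally show ?thesis .
  qed (simp add: F_def)
  then have "(\<integral>\<^sup>+z. ennreal (F z) \<partial>lborel) \<le> (\<integral>\<^sup>+z. (\<Sum>k. ennreal (m k) * indicator (A k) z) \<partial>lborel)"
    by (rule nn_integral_mono)
  moreover have "(\<integral>\<^sup>+z. (\<Sum>k. ennreal (m k) * indicator (A k) z) \<partial>lborel) = (\<Sum>k. ennreal (K * q ^ k))"
    by (subst nn_integral_suminf) (simp_all add: nn_integral_cmult_indicator[OF A_sets] term_eq)
  moreover have "(\<Sum>k. ennreal (K * q ^ k)) < \<infinity>"
  proof -
    have "0 \<le> K" "0 \<le> q" "q < 1"
      using r c conv by (simp_all add: K_def q_def n_def)
    then have "(\<Sum>k. ennreal (K * q ^ k)) = ennreal (\<Sum>k. K * q ^ k)"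
      by (intro suminf_ennreal2) (auto intro!: summable_mult summable_geometric)
    then show ?thesis by simp
  qed
  ultimately have "(\<integral>\<^sup>+z. ennreal (F z) \<partial>lborel) < \<infinity>"
    by (simp only: le_less_trans)
  then have "integrable lborel F"
    by (intro integrableI_nonneg) (auto simp: F_def)
  then show ?thesis
    unfolding set_integrable_def F_def real_scaleR_def .
qed

lemma dyadic_floor:
  fixes x :: real
  assumes "1 \<le> x"
  obtains k :: nat where "2 ^ k \<le> x" "x < 2 ^ (k + 1)"
proof -
  define k where "k = nat \<lfloor>log 2 x\<rfloor>"
  have "real k \<le> log 2 x" "log 2 x < real (k + 1)"
    using assms by (auto simp: k_def) linarith
  then have "2 powr real k \<le> x" "x < 2 powr real (k + 1)"
    using assms by (simp_all add: le_log_iff log_less_iff)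
  then show thesis
    using powr_realpow[of 2 k] powr_realpow[of 2 "k + 1"] by (intro that[of k]) simp_all
qed

text \<open>Shells of doubling radii starting at \<open>\<epsilon>\<close>; their contributions have
  ratio 2^(n-b), which is below 1 exactly when b exceeds the dimension n.\<close>

lemma set_integrable_norm_powr_at_infinity:
  assumes "real DIM('a) < b" and "0 < \<epsilon>"
  shows "set_integrable lborel {z :: 'a::euclidean_space. norm z > \<epsilon>} (\<lambda>z. norm z powr (- b))"
proof (rule set_integrable_norm_powr_shells[where r = 2 and c = \<epsilon>])
  show "2 powr (real DIM('a) - b) < 1"
    using assms powr_less_mono[of "real DIM('a) - b" 0 2] by simp
  fix z :: 'a
  assume "z \<in> {z. norm z > \<epsilon>}"
  then have z: "1 \<le> norm z / \<epsilon>" using assms by (simp add: field_simps)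
  then obtain k where "2 ^ k \<le> norm z / \<epsilon>" "norm z / \<epsilon> < 2 ^ (k + 1)"
    using dyadic_floor by blast
  then show "\<exists>k. \<epsilon> * 2 ^ k \<le> norm z \<and> norm z \<le> 2 * (\<epsilon> * 2 ^ k)"
    using assms by (intro exI[of _ k]) (auto simp: field_simps)
qed (use assms in simp_all)

text \<open>Shells of halving radii; the ratio of their contributions is 2^(b-n). The origin lies in
  no shell and is therefore left out of the set.\<close>

lemma set_integrable_norm_powr_at_0:
  assumes "b < real DIM('a)"
  shows "set_integrable lborel {z :: 'a::euclidean_space. 0 < norm z \<and> norm z \<le> 1} (\<lambda>z. norm z powr (- b))"
proof (rule set_integrable_norm_powr_shells[where r = "1/2" and c = 1])
  have "(1/2) powr (real DIM('a) - b) = 2 powr (b - real DIM('a))"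
    by (simp add: powr_divide powr_minus_divide[symmetric])
  then show "(1/2) powr (real DIM('a) - b) < 1"
    using assms powr_less_mono[of "b - real DIM('a)" 0 2] by simp
  fix z :: 'a
  assume "z \<in> {z. 0 < norm z \<and> norm z \<le> 1}"
  then have z: "0 < norm z" "1 \<le> 1 / norm z" by (simp_all add: field_simps)
  then obtain k where "2 ^ k \<le> 1 / norm z" "1 / norm z < 2 ^ (k + 1)"
    using dyadic_floor by blast
  then show "\<exists>k. 1 * (1/2) ^ k \<le> norm z \<and> norm z \<le> 2 * (1 * (1/2) ^ k)"
    \<comment> \<open>Inverting the dyadic bounds turns the upper end \<open>2 ^ (k + 1)\<close>
      into the inner radius, hence \<open>Suc k\<close>.\<close>
    using z by (intro exI[of _ "Suc k"]) (auto simp: field_simps power_divide)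
qed auto

subsection \<open>The fractional Laplacian of smooth functions\<close>

lemma flat_algebra_measurable: "f \<in> flat_algebra \<Longrightarrow> f \<in> borel_measurable borel"
  by (intro borel_measurable_continuous_onI flat_algebra_continuous)

text \<open>Away from \<open>x\<close> boundedness of \<open>u\<close> and the decay of the kernel
  give integrability. Near \<open>x\<close>, averaging over \<open>z\<close> and \<open>- z\<close>
  replaces the first difference by half a second difference, which is quadratic in \<open>z\<close>;
  dominated convergence then yields the limit.\<close>

lemma frac_laplacian_exists_flat_algebra:
  fixes u :: "real ^ 'n::finite \<Rightarrow> real"
  assumes \<sigma>: "0 < \<sigma>" "\<sigma> < 1" and u: "u \<in> flat_algebra" and M: "\<And>y. \<bar>u y\<bar> \<le> M"
  shows "frac_laplacian_exists \<sigma> u x"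
proof -
  define a where "a = real CARD('n) + 2 * \<sigma>"
  have [measurable]: "u \<in> borel_measurable borel"
    by (rule flat_algebra_measurable[OF u])
  have tail: "integrable lborel (\<lambda>z :: real ^ 'n. indicator {z. norm z > \<epsilon>} z * norm z powr (- a))"
    if "\<epsilon> > 0" for \<epsilon>
    using set_integrable_norm_powr_at_infinity[of a \<epsilon>, where ?'a = "real ^ 'n"] that \<sigma>
    by (simp add: a_def set_integrable_def)
  define k where "k \<epsilon> z = indicator {z. norm z > \<epsilon>} z * ((u x - u (x + z)) / norm z powr a)"
    for \<epsilon> and z :: "real ^ 'n"
  have [measurable]: "k \<epsilon> \<in> borel_measurable borel" for \<epsilon>
    unfolding k_def by measurable
  have k_integrable: "integrable lborel (k \<epsilon>)" if "\<epsilon> > 0" for \<epsilon>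
  proof (rule Bochner_Integration.integrable_bound)
    show "integrable lborel (\<lambda>z :: real ^ 'n. 2 * M * (indicator {z. norm z > \<epsilon>} z * norm z powr (- a)))"
      by (intro integrable_mult_right tail that)
    have "\<bar>u x - u (x + z)\<bar> \<le> 2 * M" for z
      using M[of x] M[of "x + z"] by linarith
    moreover have "0 \<le> M" using M[of x] by linarith
    ultimately show "AE z in lborel. norm (k \<epsilon> z) \<le>
        norm (2 * M * (indicator {z. norm z > \<epsilon>} z * norm z powr (- a)))"
      by (intro AE_I2) (auto simp: k_def powr_minus indicator_def abs_mult divide_inverse intro!: mult_right_mono)
  qed simp
  have kernel: "indicator {y. norm (x - y) > \<epsilon>} y *\<^sub>R frac_kernel \<sigma> u x y = k \<epsilon> (- x + 1 *\<^sub>R y)" for \<epsilon> y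
    by (simp add: k_def frac_kernel_def a_def norm_minus_commute indicator_def)
  have "set_integrable lborel {y. norm (x - y) > \<epsilon>} (frac_kernel \<sigma> u x)" if "\<epsilon> > 0" for \<epsilon>
    unfolding set_integrable_def kernel
    by (subst lborel_integrable_affine_iff) (simp_all add: k_integrable that)
  moreover have "\<exists>l. (truncated_integral \<sigma> u x \<longlongrightarrow> l) (at_right 0)"
  proof -
    define G where "G z = (2 * u x - u (x + z) - u (x - z)) / norm z powr a" for z
    have [measurable]: "G \<in> borel_measurable borel"
      unfolding G_def by measurable
    have sym: "truncated_integral \<sigma> u x \<epsilon> = (\<integral>z. indicator {z. norm z > \<epsilon>} z * G z \<partial>lborel) / 2"
      if "\<epsilon> > 0" for \<epsilon>
    proof -
      have 1: "truncated_integral \<sigma> u x \<epsilon> = (\<integral>z. k \<epsilon> z \<partial>lborel)"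
        unfolding truncated_integral_def set_lebesgue_integral_def kernel
        by (subst (2) lborel_integral_affine[of _ 1 "- x"]) simp_all
      \<comment> \<open>The truncated region is symmetric about \<open>x\<close>, so reflection
        leaves the integral unchanged and the two copies can be averaged.\<close>
      have 2: "(\<integral>z. k \<epsilon> z \<partial>lborel) = (\<integral>z. k \<epsilon> (- z) \<partial>lborel)"
        by (subst lborel_integral_affine[of _ "- 1" 0]) simp_all
      have "integrable lborel (\<lambda>z. k \<epsilon> (0 + (- 1) *\<^sub>R z))"
        by (subst lborel_integrable_affine_iff) (simp_all add: k_integrable that)
      then have "(\<integral>z. k \<epsilon> z + k \<epsilon> (- z) \<partial>lborel) = (\<integral>z. k \<epsilon> z \<partial>lborel) + (\<integral>z. k \<epsilon> (- z) \<partial>lborel)"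
        by (intro Bochner_Integration.integral_add k_integrable that) simp
      moreover have "k \<epsilon> z + k \<epsilon> (- z) = indicator {z. norm z > \<epsilon>} z * G z" for z
        by (simp add: k_def G_def indicator_def flip: add_divide_distrib)
      ultimately show ?thesis
        using 1 2 by simp
    qed
    obtain C where C: "\<And>z. norm z \<le> 1 \<Longrightarrow> \<bar>2 * u x - u (x + z) - u (x - z)\<bar> \<le> C * (norm z)\<^sup>2"
      using flat_algebra_second_difference[OF u] by blast
    \<comment> \<open>The first summand is integrable near 0 since \<open>\<sigma> < 1\<close> makes
      \<open>a - 2\<close> smaller than the dimension; the second is integrable at infinity since
      \<open>\<sigma> > 0\<close> makes \<open>a\<close> larger than it.\<close>
    define w where "w z = C * (indicator {z. 0 < norm z \<and> norm z \<le> 1} z * norm z powr (- (a - 2)))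
        + 4 * M * (indicator {z. norm z > 1} z * norm z powr (- a))" for z :: "real ^ 'n"
    have G_le: "\<bar>G z\<bar> \<le> w z" for z
    proof -
      consider "z = 0" | "0 < norm z" "norm z \<le> 1" | "norm z > 1" by fastforce
      then show ?thesis
      proof cases
        case 1
        then show ?thesis by (simp add: G_def w_def)
      next
        case 2
        have "\<bar>G z\<bar> \<le> C * (norm z)\<^sup>2 / norm z powr a"
          using C[of z] 2 by (simp add: G_def divide_right_mono)
        also have "\<dots> = C * norm z powr (- (a - 2))"
          using 2 by (simp add: powr_diff powr_numeral)
        finally show ?thesis using 2 by (simp add: w_def)
      next
        case 3
        have "\<bar>2 * u x - u (x + z) - u (x - z)\<bar> \<le> 4 * M"
          using M[of x] M[of "x + z"] M[of "x - z"] by linarith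
        then have "\<bar>G z\<bar> \<le> 4 * M / norm z powr a"
          by (simp add: G_def divide_right_mono)
        then show ?thesis
          using 3 by (simp add: w_def powr_minus divide_inverse)
      qed
    qed
    \<comment> \<open>The truncation radius is written as \<open>inverse t\<close>, to fit dominated
      convergence along \<open>t\<close> tending to infinity.\<close>
    have "((\<lambda>t. \<integral>z. indicator {z. norm z > inverse t} z * G z \<partial>lborel) \<longlongrightarrow> (\<integral>z. G z \<partial>lborel)) at_top"
    proof (rule integral_dominated_convergence_at_top[where w = w])
      have "integrable lborel (\<lambda>z :: real ^ 'n. indicator {z. 0 < norm z \<and> norm z \<le> 1} z * norm z powr (- (a - 2)))"
        using set_integrable_norm_powr_at_0[of "a - 2", where ?'a = "real ^ 'n"] \<sigma>
        by (simp add: a_def set_integrable_def)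
      then show "integrable lborel w"
        unfolding w_def by (intro Bochner_Integration.integrable_add integrable_mult_right tail) auto
      show "\<forall>\<^sub>F t in at_top. AE z in lborel. norm (indicator {z. norm z > inverse t} z * G z) \<le> w z"
        using G_le by (intro always_eventually allI AE_I2) (auto simp: indicator_def intro: order_trans[OF abs_ge_zero])
      have "((\<lambda>t. indicator {z. norm z > inverse t} z * G z) \<longlongrightarrow> G z) at_top" for z
      proof (cases "z = 0")
        case False
        have "(inverse \<longlongrightarrow> (0::real)) at_top"
          by (rule tendsto_inverse_0_at_top) (rule filterlim_ident)
        then have "\<forall>\<^sub>F t in at_top. inverse t < norm z"
          using False by (intro order_tendstoD) auto
        then have "\<forall>\<^sub>F t in at_top. indicator {z. norm z > inverse t} z * G z = G z"
          by eventually_elim simp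
        then show ?thesis
          by (rule tendsto_eventually)
      qed (simp add: G_def)
      then show "AE z in lborel. ((\<lambda>t. indicator {z. norm z > inverse t} z * G z) \<longlongrightarrow> G z) at_top"
        by simp
    qed measurable
    then have "((\<lambda>\<epsilon>. (\<integral>z. indicator {z. norm z > \<epsilon>} z * G z \<partial>lborel) / 2) \<longlongrightarrow> (\<integral>z. G z \<partial>lborel) / 2) (at_right 0)"
      by (intro tendsto_divide) (auto simp: filterlim_at_right_to_top)
    then have "(truncated_integral \<sigma> u x \<longlongrightarrow> (\<integral>z. G z \<partial>lborel) / 2) (at_right 0)"
      by (rule Lim_transform_eventually) (auto simp: eventually_at_filter sym)
    then show ?thesis ..
  qed
  ultimately show ?thesis
    by (auto simp: frac_laplacian_exists_def)
qed

text \<open>For \<open>\<epsilon> < R - norm x\<close> the truncation removes only points of the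
  plateau, where the numerator vanishes. The truncated integrals are thus eventually constant and no
  cancellation is involved.\<close>

lemma frac_laplacian_eq_integral_on_plateau:
  fixes u :: "real ^ 'n::finite \<Rightarrow> real"
  assumes "\<And>y. norm y < R \<Longrightarrow> u y = c" and "norm x < R"
  shows "frac_laplacian \<sigma> u x =
    frac_const CARD('n) \<sigma> * (\<integral>y. (c - u y) / norm (x - y) powr (real CARD('n) + 2 * \<sigma>) \<partial>lborel)"
proof -
  have "truncated_integral \<sigma> u x \<epsilon> =
      (\<integral>y. (c - u y) / norm (x - y) powr (real CARD('n) + 2 * \<sigma>) \<partial>lborel)" if "\<epsilon> < R - norm x" for \<epsilon>
  proof -
    have "indicator {y. norm (x - y) > \<epsilon>} y *\<^sub>R frac_kernel \<sigma> u x y =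
        (c - u y) / norm (x - y) powr (real CARD('n) + 2 * \<sigma>)" for y
    proof (cases "norm (x - y) > \<epsilon>")
      case False
      have "norm y \<le> norm x + norm (x - y)"
        by (metis norm_minus_commute norm_triangle_sub)
      then have "u y = c"
        using that False assms(1)[of y] by simp
      then show ?thesis using False by simp
    qed (simp add: frac_kernel_def assms)
    then show ?thesis
      by (simp add: truncated_integral_def set_lebesgue_integral_def)
  qed
  moreover have "\<forall>\<^sub>F \<epsilon> in at_right 0. \<epsilon> < R - norm x"
    using assms(2) by (intro order_tendstoD(2)[OF tendsto_ident_at]) simp
  ultimately have "(truncated_integral \<sigma> u x \<longlongrightarrow>
      (\<integral>y. (c - u y) / norm (x - y) powr (real CARD('n) + 2 * \<sigma>) \<partial>lborel)) (at_right 0)"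
    by (intro tendsto_eventually) (auto elim: eventually_mono)
  then show ?thesis
    by (simp add: frac_laplacian_def tendsto_Lim)
qed

lemma frac_const_pos: "0 < \<sigma> \<Longrightarrow> \<sigma> < 1 \<Longrightarrow> 0 < frac_const n \<sigma>"
  unfolding frac_const_def by (intro divide_pos_pos mult_pos_pos Gamma_real_pos) auto

subsection \<open>The plateau with a distant hump\<close>

lemma flat_exp_1_simps [simp]:
  "flat_exp 1 t = 0 \<longleftrightarrow> t \<le> 0"
  "0 < flat_exp 1 t \<longleftrightarrow> 0 < t"
  "0 \<le> flat_exp 1 t"
  by (auto simp: flat_exp_def)

lemma flat_exp_1_le_1: "flat_exp 1 t \<le> 1"
  by (simp add: flat_exp_def)

lemma flat_exp_1_ge: "1 \<le> t \<Longrightarrow> exp (- 1) \<le> flat_exp 1 t"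
  by (simp add: flat_exp_def)

text \<open>\<open>flat_exp 1\<close> is at least \<open>exp (- 1)\<close> on \<open>{1..}\<close> and zero on \<open>{..0}\<close>, so composing it with
  \<open>exp (- 1) - _\<close> gives a function that is constant on one side and zero on the other.\<close>

definition plateau :: "real \<Rightarrow> real ^ 'n::finite \<Rightarrow> real" where
  "plateau r y = flat_exp 1 (exp (- 1) - flat_exp 1 (r * (y \<bullet> y) - 1)) / flat_exp 1 (exp (- 1))"

text \<open>The argument uses \<open>y \<bullet> y\<close>, a polynomial in the coordinates, to stay
  inside \<open>flat_algebra\<close>. With \<open>r = inverse (R\<^sup>2)\<close> the thresholds 1
  and 4 are the radii \<open>R\<close> and \<open>2 * R\<close>.\<close>

definition annulus :: "real \<Rightarrow> real ^ 'n::finite \<Rightarrow> real" where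
  "annulus r y = flat_exp 1 (r * (y \<bullet> y) - 1) * flat_exp 1 (4 - r * (y \<bullet> y))"

lemma plateau_in_flat_algebra: "plateau r \<in> flat_algebra"
proof -
  have "(\<lambda>y. inverse (flat_exp 1 (exp (- 1))) *
      flat_exp 1 (exp (- 1) + - 1 * flat_exp 1 (r * (y \<bullet> y) + - 1))) \<in> flat_algebra"
    by (intro flat_algebra.mult flat_algebra.const flat_algebra.flat flat_algebra.add flat_algebra_inner)
  then show ?thesis
    by (simp add: plateau_def[abs_def] divide_inverse mult.commute)
qed

lemma annulus_in_flat_algebra: "annulus r \<in> flat_algebra"
proof -
  have "(\<lambda>y. flat_exp 1 (r * (y \<bullet> y) + - 1) * flat_exp 1 (4 + - r * (y \<bullet> y))) \<in> flat_algebra"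
    by (intro flat_algebra.mult flat_algebra.const flat_algebra.flat flat_algebra.add flat_algebra_inner)
  then show ?thesis
    by (simp add: annulus_def[abs_def])
qed

text \<open>The upper bound only inserts \<open>flat_exp 1 \<le> 1\<close> in the numerator; it is
  not sharp, but it enters nothing except dominating constants.\<close>

lemma plateau_bounds: "0 \<le> plateau r y" "plateau r y \<le> 1 / flat_exp 1 (exp (- 1))"
  by (auto simp: plateau_def flat_exp_1_le_1 intro!: divide_nonneg_nonneg divide_right_mono)

lemma annulus_bounds: "0 \<le> annulus r y" "annulus r y \<le> 1"
  by (auto simp: annulus_def flat_exp_1_le_1 intro!: mult_nonneg_nonneg mult_le_one)

lemma plateau_eq_1: "r * (y \<bullet> y) \<le> 1 \<Longrightarrow> plateau r y = 1"
  by (simp add: plateau_def less_imp_neq[symmetric] flat_exp_def)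

lemma plateau_eq_0: "4 \<le> r * (y \<bullet> y) \<Longrightarrow> plateau r y = 0"
  using flat_exp_1_ge[of "r * (y \<bullet> y) - 1"] by (simp add: plateau_def)

lemma annulus_eq_0: "r * (y \<bullet> y) \<le> 1 \<or> 4 \<le> r * (y \<bullet> y) \<Longrightarrow> annulus r y = 0"
  by (auto simp: annulus_def)

text \<open>A nonnegative integrable function with zero integral vanishes almost everywhere, whereas
  this one is positive on a nonempty open shell. Integrability comes from domination by the kernel
  outside the unit ball.\<close>

lemma annulus_integral_pos:
  fixes a :: real
  assumes "real CARD('n) < a"
  shows "0 < (\<integral>z. annulus 1 (z :: real ^ 'n::finite) / norm z powr a \<partial>lborel)"
proof -
  let ?f = "\<lambda>z :: real ^ 'n. annulus 1 z / norm z powr a"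
  have [measurable]: "annulus 1 \<in> borel_measurable (borel :: (real ^ 'n) measure)"
    by (rule flat_algebra_measurable[OF annulus_in_flat_algebra])
  have nonneg: "0 \<le> ?f z" for z
    by (simp add: annulus_bounds)
  have "integrable lborel (\<lambda>z :: real ^ 'n. indicator {z. norm z > 1} z * norm z powr (- a))"
    using set_integrable_norm_powr_at_infinity[of a 1, where ?'a = "real ^ 'n"] assms
    by (simp add: set_integrable_def)
  then have int: "integrable lborel ?f"
  proof (rule Bochner_Integration.integrable_bound)
    have "?f z \<le> indicator {z. norm z > 1} z * norm z powr (- a)" for z
    proof (cases "norm z > 1")
      case True
      then show ?thesis
        by (simp add: powr_minus divide_inverse mult_left_le_one_le annulus_bounds)
    next
      case False
      then have "z \<bullet> z \<le> 1"
        by (simp add: dot_square_norm power_le_one)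
      then show ?thesis by (simp add: annulus_eq_0)
    qed
    then show "AE z in lborel. norm (?f z) \<le> norm (indicator {z. norm z > 1} z * norm z powr (- a))"
      by (intro AE_I2) (simp add: annulus_bounds)
  qed measurable
  have "(\<integral>z. ?f z \<partial>lborel) \<noteq> 0"
  proof
    assume "(\<integral>z. ?f z \<partial>lborel) = 0"
    then have "AE z in lborel. ?f z = 0"
      using integral_nonneg_eq_0_iff_AE[OF int] nonneg by simp
    then have null: "AE z in lborel. z \<notin> {z :: real ^ 'n. 1 < z \<bullet> z \<and> z \<bullet> z < 4}"
      by (rule AE_mp) (auto intro!: AE_I2 simp: annulus_def)
    have op: "open {z :: real ^ 'n. 1 < z \<bullet> z \<and> z \<bullet> z < 4}"
      by (intro open_Collect_conj open_Collect_less continuous_intros)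
    then have "{z :: real ^ 'n. 1 < z \<bullet> z \<and> z \<bullet> z < 4} \<in> null_sets lborel"
      using null by (subst AE_iff_null_sets) auto
    then have "negligible {z :: real ^ 'n. 1 < z \<bullet> z \<and> z \<bullet> z < 4}"
      by (simp add: negligible_iff_null_sets null_sets_completionI)
    \<comment> \<open>Any coordinate direction will do, so \<open>undefined\<close> names one; the
      length 3/2 has square 9/4, between 1 and 4.\<close>
    moreover have "axis undefined (3/2) \<in> {z :: real ^ 'n. 1 < z \<bullet> z \<and> z \<bullet> z < 4}"
      by (simp add: inner_axis_axis)
    ultimately show False
      using op open_not_negligible by blast
  qed
  moreover have "0 \<le> (\<integral>z. ?f z \<partial>lborel)"
    using nonneg by simp
  ultimately show ?thesis by simp
qed

section \<open>The bump functions and the limit of their rescaled integrals\<close>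

definition bump :: "real \<Rightarrow> real \<Rightarrow> real \<Rightarrow> real ^ 'n::finite \<Rightarrow> real" where
  "bump \<sigma> c R y = plateau (inverse (R\<^sup>2)) y + c * R powr (2 * \<sigma>) * annulus (inverse (R\<^sup>2)) y"

lemma bump_in_flat_algebra: "bump \<sigma> c R \<in> flat_algebra"
  unfolding bump_def[abs_def]
  by (intro flat_algebra.add flat_algebra.mult flat_algebra.const plateau_in_flat_algebra annulus_in_flat_algebra)

lemma bump_nonneg: "0 \<le> c \<Longrightarrow> 0 \<le> bump \<sigma> c R y"
  by (simp add: bump_def plateau_bounds annulus_bounds)

lemma inverse_square_inner:
  fixes y :: "'a::real_inner"
  shows "inverse (R\<^sup>2) * (y \<bullet> y) = (norm y / R)\<^sup>2"
  by (simp add: dot_square_norm power_divide divide_inverse power_mult_distrib power_inverse)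

lemma bump_eq_1:
  assumes "norm y < R"
  shows "bump \<sigma> c R y = 1"
proof -
  have "0 < R" using assms norm_ge_zero[of y] by linarith
  then have "(norm y / R)\<^sup>2 \<le> 1"
    using assms by (intro power_le_one) auto
  then show ?thesis
    by (simp add: bump_def inverse_square_inner plateau_eq_1 annulus_eq_0)
qed

lemma bump_compactly_supported:
  assumes "0 < R"
  shows "compactly_supported (bump \<sigma> c R :: real ^ 'n::finite \<Rightarrow> real)"
proof -
  have "bump \<sigma> c R y = 0" if "2 * R < norm y" for y :: "real ^ 'n"
  proof -
    have "2\<^sup>2 \<le> (norm y / R)\<^sup>2"
      using that assms by (intro power_mono) (auto simp: field_simps)
    then show ?thesis
      by (simp add: bump_def inverse_square_inner plateau_eq_0 annulus_eq_0)
  qed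
  then have "{y :: real ^ 'n. bump \<sigma> c R y \<noteq> 0} \<subseteq> cball 0 (2 * R)"
    by (force simp: not_less[symmetric])
  then show ?thesis
    unfolding compactly_supported_def by (metis bounded_cball bounded_subset compact_closure)
qed

lemma bump_bounded: "\<exists>M. \<forall>y :: real ^ 'n::finite. \<bar>bump \<sigma> c R y\<bar> \<le> M"
proof -
  have "\<bar>bump \<sigma> c R y\<bar> \<le> 1 / flat_exp 1 (exp (- 1)) + \<bar>c\<bar> * R powr (2 * \<sigma>) * 1" for y :: "real ^ 'n"
    unfolding bump_def
    using plateau_bounds[of _ y] annulus_bounds[of _ y]
    by (intro order_trans[OF abs_triangle_ineq] add_mono) (auto simp: abs_mult intro!: mult_left_le)
  then show ?thesis by blast
qed

text \<open>The substitution \<open>y = R z\<close> makes the factor \<open>R powr (2 * \<sigma>)\<close> of the annulus cancel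
  against the homogeneity of the kernel.\<close>

lemma bump_integral_rescale:
  fixes x :: "real ^ 'n::finite" and \<sigma> :: real
  assumes R: "0 < R"
  defines "a \<equiv> real CARD('n) + 2 * \<sigma>"
  shows "(\<integral>y. (1 - bump \<sigma> c R y) / norm (x - y) powr a \<partial>lborel) =
    (\<integral>z. ((1 - plateau 1 z) * R powr (- 2 * \<sigma>) - c * annulus 1 z) / norm (x /\<^sub>R R - z) powr a \<partial>lborel)"
proof -
  have [measurable]: "bump \<sigma> c R \<in> borel_measurable (borel :: (real ^ 'n) measure)"
    by (rule flat_algebra_measurable[OF bump_in_flat_algebra])
  have integrand: "R ^ CARD('n) * ((1 - bump \<sigma> c R (R *\<^sub>R z)) / norm (x - R *\<^sub>R z) powr a) =
      ((1 - plateau 1 z) * R powr (- 2 * \<sigma>) - c * annulus 1 z) / norm (x /\<^sub>R R - z) powr a" for z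
  proof -
    have "inverse (R\<^sup>2) * ((R *\<^sub>R z) \<bullet> (R *\<^sub>R z)) = z \<bullet> z"
      using R by (simp add: power2_eq_square field_simps)
    then have "plateau (inverse (R\<^sup>2)) (R *\<^sub>R z) = plateau 1 z" "annulus (inverse (R\<^sup>2)) (R *\<^sub>R z) = annulus 1 z"
      by (simp_all only: plateau_def annulus_def mult_1)
    then have bump_R: "1 - bump \<sigma> c R (R *\<^sub>R z) = (1 - plateau 1 z) - c * R powr (2 * \<sigma>) * annulus 1 z"
      by (simp add: bump_def)
    have "x - R *\<^sub>R z = R *\<^sub>R (x /\<^sub>R R - z)"
      using R by (simp add: algebra_simps)
    then have "norm (x - R *\<^sub>R z) = R * norm (x /\<^sub>R R - z)"
      using R by (metis abs_of_pos norm_scaleR)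
    \<comment> \<open>The first power of \<open>R\<close> cancels the Jacobian; the second becomes
      the decaying factor on the plateau term.\<close>
    then have "norm (x - R *\<^sub>R z) powr a = R powr real CARD('n) * R powr (2 * \<sigma>) * norm (x /\<^sub>R R - z) powr a"
      using R by (simp add: powr_mult a_def powr_add)
    then have "R ^ CARD('n) * ((1 - bump \<sigma> c R (R *\<^sub>R z)) / norm (x - R *\<^sub>R z) powr a) =
        (1 - bump \<sigma> c R (R *\<^sub>R z)) * R powr (- 2 * \<sigma>) / norm (x /\<^sub>R R - z) powr a"
      using R by (simp add: powr_realpow powr_minus divide_inverse)
    moreover have "(1 - bump \<sigma> c R (R *\<^sub>R z)) * R powr (- 2 * \<sigma>) =
        (1 - plateau 1 z) * R powr (- 2 * \<sigma>) - c * annulus 1 z"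
      using R unfolding bump_R by (simp add: powr_minus field_simps)
    ultimately show ?thesis by simp
  qed
  have "(\<integral>y. (1 - bump \<sigma> c R y) / norm (x - y) powr a \<partial>lborel) =
      R ^ CARD('n) * (\<integral>z. (1 - bump \<sigma> c R (R *\<^sub>R z)) / norm (x - R *\<^sub>R z) powr a \<partial>lborel)"
    using R by (subst lborel_integral_affine[of _ R 0]) simp_all
  also have "\<dots> = (\<integral>z. R ^ CARD('n) * ((1 - bump \<sigma> c R (R *\<^sub>R z)) / norm (x - R *\<^sub>R z) powr a) \<partial>lborel)"
    by (rule integral_mult_right_zero[symmetric])
  also have "\<dots> = (\<integral>z. ((1 - plateau 1 z) * R powr (- 2 * \<sigma>) - c * annulus 1 z) / norm (x /\<^sub>R R - z) powr a \<partial>lborel)"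
    by (simp only: integrand)
  finally show ?thesis .
qed

text \<open>After rescaling, the integrand vanishes on the unit ball, while the singularity
  \<open>x /\<^sub>R R\<close> tends to its centre. Dominated convergence therefore applies: the
  plateau term dies and the hump term keeps its size.\<close>

lemma bump_integral_tendsto:
  fixes x :: "real ^ 'n::finite" and \<sigma> :: real
  assumes \<sigma>: "0 < \<sigma>"
  defines "a \<equiv> real CARD('n) + 2 * \<sigma>"
  shows "((\<lambda>R. \<integral>y. (1 - bump \<sigma> c R y) / norm (x - y) powr a \<partial>lborel) \<longlongrightarrow>
    - c * (\<integral>z. annulus 1 (z :: real ^ 'n) / norm z powr a \<partial>lborel)) at_top"
proof -
  define B where "B = 1 / flat_exp 1 (exp (- 1))"
  define s where "s R z = ((1 - plateau 1 z) * R powr (- 2 * \<sigma>) - c * annulus 1 z) / norm (x /\<^sub>R R - z) powr a"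
    for R and z :: "real ^ 'n"
  have [measurable]: "plateau 1 \<in> borel_measurable (borel :: (real ^ 'n) measure)"
      "annulus 1 \<in> borel_measurable (borel :: (real ^ 'n) measure)"
    by (auto intro: flat_algebra_measurable plateau_in_flat_algebra annulus_in_flat_algebra)
  have a: "0 < a" "real CARD('n) < a"
    using \<sigma> by (auto simp: a_def intro: add_nonneg_pos)
  have inside: "plateau 1 z = 1" "annulus 1 z = 0" if "norm z \<le> 1" for z :: "real ^ 'n"
    using that by (auto simp: plateau_eq_1 annulus_eq_0 dot_square_norm power_le_one)
  \<comment> \<open>\<open>1 + B + \<bar>c\<bar>\<close> bounds the numerator;
    \<open>2 powr a\<close> pays for replacing the distance to \<open>x /\<^sub>R R\<close> by half
    of \<open>norm z\<close>.\<close>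
  let ?w = "\<lambda>z :: real ^ 'n. (1 + B + \<bar>c\<bar>) * 2 powr a * (indicator {z. norm z > 1} z * norm z powr (- a))"
  have "((\<lambda>R. \<integral>z. s R z \<partial>lborel) \<longlongrightarrow> (\<integral>z. - c * (annulus 1 (z :: real ^ 'n) / norm z powr a) \<partial>lborel)) at_top"
  proof (rule integral_dominated_convergence_at_top[where w = ?w])
    show "integrable lborel ?w"
      using set_integrable_norm_powr_at_infinity[of a 1, where ?'a = "real ^ 'n"] a
      by (intro integrable_mult_right) (simp add: set_integrable_def)
    show "\<forall>\<^sub>F R in at_top. AE z in lborel. norm (s R z) \<le> ?w z"
      \<comment> \<open>This threshold gives both \<open>R \<ge> 1\<close>, so that the power of
        \<open>R\<close> is at most 1, and \<open>norm (x /\<^sub>R R) \<le> 1 / 2\<close>.\<close>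
      using eventually_ge_at_top[of "1 + 2 * norm x"]
    proof eventually_elim
      case (elim R)
      then have R: "1 \<le> R" "2 * norm x \<le> R"
        using norm_ge_zero[of x] by linarith+
      have "norm (s R z) \<le> ?w z" for z
      proof (cases "norm z > 1")
        case False
        then show ?thesis by (simp add: s_def inside)
      next
        case True
        have "norm (x /\<^sub>R R) \<le> 1 / 2"
          using R by (simp add: field_simps)
        then have far: "norm z / 2 \<le> norm (x /\<^sub>R R - z)"
          using True norm_triangle_ineq2[of z "x /\<^sub>R R"] by (simp add: norm_minus_commute)
        have "\<bar>1 - plateau 1 z\<bar> \<le> 1 + B"
          using plateau_bounds[of 1 z] by (simp add: B_def)
        moreover have "R powr (- 2 * \<sigma>) \<le> 1"
          using R \<sigma> powr_mono[of "- 2 * \<sigma>" 0 R] by simp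
        ultimately have near: "\<bar>(1 - plateau 1 z) * R powr (- 2 * \<sigma>)\<bar> \<le> 1 + B"
          using mult_mono[of "\<bar>1 - plateau 1 z\<bar>" "1 + B" "R powr (- 2 * \<sigma>)" 1] by (simp add: abs_mult)
        have "\<bar>c * annulus 1 z\<bar> \<le> \<bar>c\<bar>"
          using annulus_bounds[of 1 z] by (simp add: abs_mult mult_left_le)
        with near have num: "\<bar>(1 - plateau 1 z) * R powr (- 2 * \<sigma>) - c * annulus 1 z\<bar> \<le> 1 + B + \<bar>c\<bar>"
          by (intro order_trans[OF abs_triangle_ineq4 add_mono])
        have "norm (s R z) \<le> (1 + B + \<bar>c\<bar>) / (norm z / 2) powr a"
          unfolding s_def real_norm_def abs_divide abs_of_nonneg[OF powr_ge_zero]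
          using far True a num
          by (intro frac_le) (auto intro!: powr_mono2 order_trans[OF abs_ge_zero num])
        also have "\<dots> = ?w z"
          using True by (simp add: powr_divide powr_minus_divide)
        finally show ?thesis .
      qed
      then show ?case by simp
    qed
    have "((\<lambda>R. s R z) \<longlongrightarrow> - c * (annulus 1 z / norm z powr a)) at_top" for z
    proof (cases "norm z \<le> 1")
      case True
      then show ?thesis by (simp add: s_def inside)
    next
      case False
      then have z: "z \<noteq> 0" by auto
      have decay: "((\<lambda>R. R powr (- 2 * \<sigma>)) \<longlongrightarrow> 0) at_top"
        using \<sigma> by (intro tendsto_neg_powr filterlim_ident) auto
      have shrink: "((\<lambda>R. x /\<^sub>R R) \<longlongrightarrow> 0 *\<^sub>R x) at_top"
        by (intro tendsto_scaleR tendsto_const tendsto_inverse_0_at_top filterlim_ident)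
      have "((\<lambda>R. s R z) \<longlongrightarrow>
          ((1 - plateau 1 z) * 0 - c * annulus 1 z) / norm (0 *\<^sub>R x - z) powr a) at_top"
        unfolding s_def using z
        by (intro tendsto_divide tendsto_diff tendsto_mult tendsto_powr tendsto_norm tendsto_const
            decay shrink) auto
      then show ?thesis by simp
    qed
    then show "AE z in lborel. ((\<lambda>R. s R z) \<longlongrightarrow> - c * (annulus 1 z / norm z powr a)) at_top"
      by simp
  qed (unfold s_def, measurable)
  then have "((\<lambda>R. \<integral>z. s R z \<partial>lborel) \<longlongrightarrow> - c * (\<integral>z. annulus 1 (z :: real ^ 'n) / norm z powr a \<partial>lborel)) at_top"
    by (simp only: integral_mult_right_zero)
  moreover have "\<forall>\<^sub>F R in at_top. (\<integral>z. s R z \<partial>lborel) = (\<integral>y. (1 - bump \<sigma> c R y) / norm (x - y) powr a \<partial>lborel)"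
    using eventually_gt_at_top[of 0]
    by eventually_elim (simp add: s_def a_def bump_integral_rescale)
  ultimately show ?thesis
    by (rule Lim_transform_eventually)
qed

section \<open>Normalisation of the hump and the resulting sequence\<close>

theorem theorem1p2:
  fixes \<sigma> :: real
  assumes "0 < \<sigma>" and "\<sigma> < 1"
  shows "\<exists>v :: nat \<Rightarrow> real ^ 'n::finite \<Rightarrow> real.
    (\<forall>j. smooth (v j) \<and> compactly_supported (v j) \<and> (\<forall>x. 0 \<le> v j x)) \<and>
    converges_C2_loc v (\<lambda>x. 1) \<and>
    (\<forall>j x. frac_laplacian_exists \<sigma> (v j) x) \<and>
    (\<forall>x. (\<lambda>j. frac_laplacian \<sigma> (v j) x) \<longlonglongrightarrow> -1)"
proof -
  define a where "a = real CARD('n) + 2 * \<sigma>"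
  define I where "I = (\<integral>z. annulus 1 (z :: real ^ 'n) / norm z powr a \<partial>lborel)"
  \<comment> \<open>The solution of
    \<open>frac_const CARD('n) \<sigma> * (- c * I) = - 1\<close>.\<close>
  define c where "c = 1 / (frac_const CARD('n) \<sigma> * I)"
  \<comment> \<open>The successor keeps the radius positive at \<open>j = 0\<close>, as compact
    support is claimed for every \<open>j\<close>.\<close>
  define R where "R j = real (Suc j)" for j
  define v where "v j = (bump \<sigma> c (R j) :: real ^ 'n \<Rightarrow> real)" for j
  have I: "0 < I"
    unfolding I_def using assms by (intro annulus_integral_pos) (simp add: a_def)
  have fc: "0 < frac_const CARD('n) \<sigma>"
    using assms by (rule frac_const_pos)
  have c: "0 < c"
    using I fc by (simp add: c_def)
  have R_top: "filterlim R at_top sequentially"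
    unfolding R_def by (rule filterlim_compose[OF filterlim_real_sequentially filterlim_Suc])
  have R_gt: "\<forall>\<^sub>F j in sequentially. b < R j" for b
    using R_top by (simp add: filterlim_at_top_dense)
  have "smooth (v j)" "compactly_supported (v j)" "\<forall>x. 0 \<le> v j x" for j
    using c by (auto simp: v_def R_def bump_nonneg
        intro: flat_algebra_smooth bump_in_flat_algebra bump_compactly_supported)
  moreover have "converges_C2_loc v (\<lambda>x. 1)"
    unfolding converges_C2_loc_def
  proof (intro allI impI)
    fix K :: "(real ^ 'n) set" and "is" :: "'n list"
    assume "compact K"
    then obtain b where b: "\<forall>x\<in>K. norm x \<le> b"
      by (auto dest!: compact_imp_bounded simp: bounded_iff)
    \<comment> \<open>Once \<open>R j\<close> exceeds \<open>b\<close>, the open plateau contains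
      \<open>K\<close>, so the derivatives coincide there exactly and the uniform error is
      zero.\<close>
    have "\<forall>\<^sub>F j in sequentially. \<forall>x\<in>K. iter_partial is (v j) x = iter_partial is (\<lambda>x. 1) x"
      using R_gt[of b]
    proof eventually_elim
      case (elim j)
      show ?case
      proof
        fix x
        assume "x \<in> K"
        then show "iter_partial is (v j) x = iter_partial is (\<lambda>x. 1) x"
          using b elim by (intro iter_partial_cong_open[of "ball 0 (R j)"]) (force simp: v_def bump_eq_1)+
      qed
    qed
    then show "uniform_limit K (\<lambda>j. iter_partial is (v j)) (iter_partial is (\<lambda>x. 1)) sequentially"
      unfolding uniform_limit_iff by (auto elim: eventually_mono)
  qed
  moreover have "frac_laplacian_exists \<sigma> (v j) x" for j x
    using bump_bounded[of \<sigma> c "R j"] assms frac_laplacian_exists_flat_algebra[OF _ _ bump_in_flat_algebra]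
    unfolding v_def by blast
  moreover have "(\<lambda>j. frac_laplacian \<sigma> (v j) x) \<longlonglongrightarrow> -1" for x
  proof -
    have "(\<lambda>j. \<integral>y. (1 - v j y) / norm (x - y) powr a \<partial>lborel) \<longlonglongrightarrow> - c * I"
      unfolding v_def I_def a_def
      by (rule filterlim_compose[OF bump_integral_tendsto R_top]) (rule assms)
    then have "(\<lambda>j. frac_const CARD('n) \<sigma> * (\<integral>y. (1 - v j y) / norm (x - y) powr a \<partial>lborel))
        \<longlonglongrightarrow> frac_const CARD('n) \<sigma> * (- c * I)"
      by (rule tendsto_mult_left)
    moreover have "\<forall>\<^sub>F j in sequentially. frac_const CARD('n) \<sigma> *
        (\<integral>y. (1 - v j y) / norm (x - y) powr a \<partial>lborel) = frac_laplacian \<sigma> (v j) x"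
      \<comment> \<open>As soon as \<open>x\<close> lies in the plateau, the fractional Laplacian is
        the ordinary integral.\<close>
      using R_gt[of "norm x"]
    proof eventually_elim
      case (elim j)
      then show ?case
        unfolding a_def
        by (intro frac_laplacian_eq_integral_on_plateau[symmetric, of "R j"]) (simp_all add: v_def bump_eq_1)
    qed
    ultimately have "(\<lambda>j. frac_laplacian \<sigma> (v j) x) \<longlonglongrightarrow> frac_const CARD('n) \<sigma> * (- c * I)"
      by (rule Lim_transform_eventually)
    also have "frac_const CARD('n) \<sigma> * (- c * I) = - 1"
      using I fc by (simp add: c_def)
    finally show ?thesis .
  qed
  ultimately show ?thesis
    by blast
qed

end
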